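(* Let $n\ge 1$ be an integer and let $K$ be a field whose characteristic is either $0$ or a positive number relatively prime to $2n$. Let $a\in K\setminus\{0\}$, and let $x_1,\ldots,x_n$ and $y_1,\ldots,y_n$ be the distinct roots of the polynomials $x^n+a$ and $x^n-a$, respectively, in the splitting field of $(x^n+a)(x^n-a)$ over $K$. Then $$\operatorname{per}\left(\left(\frac{1}{x_i-y_j}\right)_{1\le i,j\le n}\right)=\begin{cases}(-1)^{\frac{n+1}{2}}\dfrac{n}{2^n a}\left(\displaystyle\prod_{k=1}^{(n-1)/2}(n-2k)\right)^2, & \text{if } n\equiv 1\pmod 2,\\[2ex] 0, & \text{if } n\equiv 0\pmod 2.\end{cases}$$
   Context: For an $n\times n$ matrix $A=(a_{i,j})$ over a commutative ring, the permanent is $\operatorname{per}(A)=\sum_{\sigma\in \mathrm{Sym}(n)}\prod_{i=1}^n a_{i,\sigma(i)}$, where $\mathrm{Sym}(n)$ is the symmetric group on $\{1,\ldots,n\}$. Empty products equal $1$. *)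

theory Defs
  imports "Jordan_Normal_Form.Matrix"
    "HOL-Combinatorics.Permutations"
    "HOL-Computational_Algebra.Polynomial"
begin

text \<open>The value on non-square matrices is a dummy, following the convention of \<open>det\<close>.\<close>

definition permanent :: "'a :: comm_ring_1 mat \<Rightarrow> 'a" where
  "permanent A = (if dim_row A = dim_col A
     then \<Sum>\<sigma> | \<sigma> permutes {0..<dim_row A}. \<Prod>i = 0..<dim_row A. A $$ (i, \<sigma> i)
     else 0)"

definition is_subfield :: "'a :: field set \<Rightarrow> bool" where
  "is_subfield S \<longleftrightarrow> 0 \<in> S \<and> 1 \<in> S \<and>
     (\<forall>u\<in>S. \<forall>v\<in>S. u - v \<in> S \<and> u * v \<in> S) \<and> (\<forall>u\<in>S. inverse u \<in> S)"

text \<open>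
  The type \<open>'l\<close>, viewed as an extension of \<open>'k\<close> along \<open>\<iota>\<close>, is a splitting field of
  the nonzero polynomial \<open>p\<close> over \<open>'k\<close>: \<open>p\<close> is a product of linear factors over \<open>'l\<close>, and no
  proper subfield of \<open>'l\<close> contains both the image of \<open>'k\<close> and all roots of \<open>p\<close>.
\<close>

definition splitting_field :: "('k :: field \<Rightarrow> 'l :: field) \<Rightarrow> 'k poly \<Rightarrow> bool" where
  "splitting_field \<iota> p \<longleftrightarrow> p \<noteq> 0 \<and> field_hom \<iota> \<and>
     (\<exists>c rs. map_poly \<iota> p = Polynomial.smult c (\<Prod>r\<leftarrow>rs. [:- r, 1:])) \<and>
     (\<forall>S. is_subfield S \<and> range \<iota> \<subseteq> S \<and> {z. poly (map_poly \<iota> p) z = 0} \<subseteq> S \<longrightarrow> S = UNIV)"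

end

theory Submission
  imports Defs "Jordan_Normal_Form.Determinant"
begin

text \<open>
  The permanent is obtained as a quotient of two determinants, by Borchardt's identity
  \<open>per(1/(x\<^sub>i - y\<^sub>j)) \<cdot> det(1/(x\<^sub>i - y\<^sub>j)) = det(1/(x\<^sub>i - y\<^sub>j)\<^sup>2)\<close>, together with the fact that the Cauchy matrix on the left is nonsingular
  (lemmas \<open>borchardt\<close> and \<open>det_cauchy_mat_nonzero\<close>).

  For \<open>x\<^sup>n = -a\<close> and \<open>y\<^sup>n = a\<close> both determinants can be compared without being computed.
  Since \<open>x\<^sup>n - y\<^sup>n = -2a\<close>, the geometric sum expresses \<open>1/(x - y)\<close> as the polynomial
  \<open>-1/(2a) \<Sum>m<n. x\<^bsup>n-1-m\<^esup> y\<^bsup>m\<^esup>\<close>, and similarly \<open>1/(x - y)\<^sup>2\<close> equals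
  \<open>1/(4ax) \<Sum>m<n. (n-2-2m) x\<^bsup>n-1-m\<^esup> y\<^bsup>m\<^esup>\<close>. If \<open>V\<close> and \<open>W\<close> denote the matrices of powers
  of the \<open>x\<^sub>i\<close> (in descending order) and of the \<open>y\<^sub>j\<close>, then the Cauchy matrix is \<open>V D W\<close> and
  the matrix of the squares is \<open>E V D' W\<close> with diagonal \<open>D\<close>, \<open>D'\<close>, \<open>E\<close>. The factors \<open>det V\<close>
  and \<open>det W\<close> cancel in the quotient, Vieta's formula \<open>\<Prod>(-x\<^sub>i) = a\<close> evaluates \<open>det E\<close>, and
  the permanent is \<open>1/(2\<^sup>n a) \<Prod>m<n. (n-2-2m)\<close>. For even \<open>n\<close> the factor with
  \<open>m = (n-2)/2\<close> vanishes; for odd \<open>n\<close> the factors other than the last one, \<open>-n\<close>, come in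
  pairs of opposite sign.
\<close>

section \<open>Borchardt's identity\<close>

definition cauchy_mat :: "nat \<Rightarrow> (nat \<Rightarrow> 'a :: field) \<Rightarrow> (nat \<Rightarrow> 'a) \<Rightarrow> 'a mat" where
  "cauchy_mat n x y = mat n n (\<lambda>(i, j). 1 / (x i - y j))"

lemma cauchy_mat_carrier [simp]: "cauchy_mat n x y \<in> carrier_mat n n"
  by (simp add: cauchy_mat_def)

text \<open>
  A permutation \<open>\<pi> \<noteq> id\<close> makes the columns dependent with the weights \<open>y j - y (\<pi> j)\<close>: by
  partial fractions, the weighted row sums are sums of the differences
  \<open>1 / (x i - y j) - 1 / (x i - y (\<pi> j))\<close>, which cancel as \<open>j\<close> runs over all indices.
\<close>

lemma det_product_permuted_cauchy_eq_0:
  fixes x y :: "nat \<Rightarrow> 'a :: field"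
  assumes inj: "inj_on y {0..<n}"
    and ne: "\<And>i j. i < n \<Longrightarrow> j < n \<Longrightarrow> x i \<noteq> y j"
    and \<pi>: "\<pi> permutes {0..<n}" "\<pi> \<noteq> id"
  shows "det (mat n n (\<lambda>(i, j). 1 / ((x i - y j) * (x i - y (\<pi> j))))) = 0"
proof -
  let ?B = "mat n n (\<lambda>(i, j). 1 / ((x i - y j) * (x i - y (\<pi> j))))"
  let ?w = "vec n (\<lambda>j. y j - y (\<pi> j))"
  have \<pi>_less: "\<pi> j < n" if "j < n" for j
    using permutes_in_image[OF \<pi>(1), of j] that by simp
  obtain j where j: "\<pi> j \<noteq> j"
    using \<pi>(2) by (auto simp: fun_eq_iff)
  then have "j < n"
    using \<pi>(1) by (auto simp: permutes_def)
  with j inj \<pi>_less have "?w $ j \<noteq> 0"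
    by (auto simp: inj_on_def)
  with \<open>j < n\<close> have "?w \<noteq> 0\<^sub>v n"
    by (metis index_zero_vec(1))
  moreover have "?B *\<^sub>v ?w = 0\<^sub>v n"
  proof (rule eq_vecI)
    fix i assume "i < dim_vec (0\<^sub>v n :: 'a vec)"
    then have i: "i < n" by simp
    have "(?B *\<^sub>v ?w) $ i = (\<Sum>j = 0..<n. 1 / ((x i - y j) * (x i - y (\<pi> j))) * (y j - y (\<pi> j)))"
      using i by (simp add: scalar_prod_def)
    also have "\<dots> = (\<Sum>j = 0..<n. 1 / (x i - y j) - 1 / (x i - y (\<pi> j)))"
      using ne i \<pi>_less by (intro sum.cong refl) (simp add: divide_simps)
    also have "\<dots> = (\<Sum>j = 0..<n. 1 / (x i - y j)) - (\<Sum>j = 0..<n. 1 / (x i - y (\<pi> j)))"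
      by (rule sum_subtractf)
    also have "(\<Sum>j = 0..<n. 1 / (x i - y (\<pi> j))) = (\<Sum>j = 0..<n. 1 / (x i - y j))"
      using sum.permute[OF \<pi>(1), of "\<lambda>j. 1 / (x i - y j)"] by (simp add: o_def)
    finally show "(?B *\<^sub>v ?w) $ i = 0\<^sub>v n $ i"
      using i by simp
  qed simp
  ultimately show ?thesis
    by (subst det_0_iff_vec_prod_zero[of _ n]) (auto intro!: exI[of _ ?w])
qed

text \<open>
  In the double sum over \<open>(\<sigma>, \<tau>)\<close> that expands the left-hand side, put \<open>\<sigma> = \<pi> \<circ> \<tau>\<close>. For a
  fixed \<open>\<pi>\<close> the sum over \<open>\<tau>\<close> is the determinant of the preceding lemma, so that only
  \<open>\<pi> = id\<close> contributes.
\<close>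

theorem borchardt:
  fixes x y :: "nat \<Rightarrow> 'a :: field"
  assumes inj: "inj_on y {0..<n}"
    and ne: "\<And>i j. i < n \<Longrightarrow> j < n \<Longrightarrow> x i \<noteq> y j"
  shows "permanent (cauchy_mat n x y) * det (cauchy_mat n x y) =
    det (mat n n (\<lambda>(i, j). 1 / (x i - y j)\<^sup>2))"
proof -
  let ?P = "{p. p permutes {0..<n}}"
  define c where "c i j = 1 / (x i - y j)" for i j
  have less: "p i < n" if "p permutes {0..<n}" "i < n" for p i
    using permutes_in_image[OF that(1), of i] that by simp
  have per: "permanent (cauchy_mat n x y) = (\<Sum>\<sigma>\<in>?P. \<Prod>i = 0..<n. c i (\<sigma> i))"
    unfolding permanent_def cauchy_mat_def c_def
    by (auto intro!: sum.cong prod.cong simp: less)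
  have det: "det (cauchy_mat n x y) = (\<Sum>\<tau>\<in>?P. signof \<tau> * (\<Prod>i = 0..<n. c i (\<tau> i)))"
    unfolding det_def cauchy_mat_def c_def
    by (auto intro!: sum.cong prod.cong simp: less)
  have "permanent (cauchy_mat n x y) * det (cauchy_mat n x y) =
      det (cauchy_mat n x y) * permanent (cauchy_mat n x y)"
    by (rule mult.commute)
  also have "\<dots> =
      (\<Sum>\<tau>\<in>?P. \<Sum>\<sigma>\<in>?P. signof \<tau> * ((\<Prod>i = 0..<n. c i (\<sigma> i)) * (\<Prod>i = 0..<n. c i (\<tau> i))))"
    unfolding per det sum_product by (intro sum.cong refl) (simp only: mult_ac)
  also have "\<dots> = (\<Sum>\<tau>\<in>?P. \<Sum>\<pi>\<in>?P. signof \<tau> * (\<Prod>i = 0..<n. c i (\<tau> i) * c i (\<pi> (\<tau> i))))"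
  proof (rule sum.cong)
    fix \<tau> assume "\<tau> \<in> ?P"
    then show "(\<Sum>\<sigma>\<in>?P. signof \<tau> * ((\<Prod>i = 0..<n. c i (\<sigma> i)) * (\<Prod>i = 0..<n. c i (\<tau> i)))) =
        (\<Sum>\<pi>\<in>?P. signof \<tau> * (\<Prod>i = 0..<n. c i (\<tau> i) * c i (\<pi> (\<tau> i))))"
      by (subst sum_permutations_compose_right[of \<tau>]) (auto simp: prod.distrib mult_ac)
  qed simp
  also have "\<dots> = (\<Sum>\<pi>\<in>?P. \<Sum>\<tau>\<in>?P. signof \<tau> * (\<Prod>i = 0..<n. c i (\<tau> i) * c i (\<pi> (\<tau> i))))"
    by (rule sum.swap)
  also have "\<dots> = (\<Sum>\<pi>\<in>?P. det (mat n n (\<lambda>(i, j). 1 / ((x i - y j) * (x i - y (\<pi> j))))))"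
    unfolding det_def c_def by (auto intro!: sum.cong prod.cong simp: less)
  also have "\<dots> = (\<Sum>\<pi>\<in>{id}. det (mat n n (\<lambda>(i, j). 1 / ((x i - y j) * (x i - y (\<pi> j))))))"
    using det_product_permuted_cauchy_eq_0[OF inj ne]
    by (intro sum.mono_neutral_right) (auto simp: permutes_id finite_permutations)
  finally show ?thesis
    by (simp add: power2_eq_square)
qed

text \<open>
  Clearing denominators turns a kernel vector \<open>v\<close> into the polynomial
  \<open>\<Sum>j. v\<^sub>j \<Prod>k\<noteq>j. (X - y\<^sub>k)\<close> of degree less than \<open>n\<close>, which vanishes at the \<open>n\<close> points \<open>x\<^sub>i\<close>.
  It is therefore zero, and its values at the \<open>y\<^sub>j\<close> show that \<open>v = 0\<close>.
\<close>

lemma det_cauchy_mat_nonzero: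
  fixes x y :: "nat \<Rightarrow> 'a :: field"
  assumes inj: "inj_on x {0..<n}" "inj_on y {0..<n}"
    and ne: "\<And>i j. i < n \<Longrightarrow> j < n \<Longrightarrow> x i \<noteq> y j"
  shows "det (cauchy_mat n x y) \<noteq> 0"
proof
  assume "det (cauchy_mat n x y) = 0"
  then obtain v where v: "v \<in> carrier_vec n" "v \<noteq> 0\<^sub>v n" "cauchy_mat n x y *\<^sub>v v = 0\<^sub>v n"
    by (auto simp: det_0_iff_vec_prod_zero[of _ n])
  define L where "L j = (\<Prod>k\<in>{0..<n} - {j}. [:- y k, 1:])" for j
  define p where "p = (\<Sum>j = 0..<n. smult (v $ j) (L j))"
  have "n > 0"
    using v by (cases n) auto
  have deg: "degree p < n"
    unfolding p_def
  proof (rule degree_sum_less)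
    fix j assume j: "j \<in> {0..<n}"
    have "degree (L j) = n - 1"
      unfolding L_def using j by (subst degree_prod_sum_eq) auto
    with \<open>n > 0\<close> show "degree (smult (v $ j) (L j)) < n"
      by (intro le_less_trans[OF degree_smult_le]) auto
  qed fact
  have root: "poly p (x i) = 0" if i: "i < n" for i
  proof -
    have "poly p (x i) = (\<Sum>j = 0..<n. v $ j * (\<Prod>k\<in>{0..<n} - {j}. x i - y k))"
      by (simp add: p_def L_def poly_sum poly_prod)
    also have "\<dots> = (\<Sum>j = 0..<n. (\<Prod>k = 0..<n. x i - y k) * (1 / (x i - y j) * v $ j))"
    proof (intro sum.cong refl)
      fix j assume j: "j \<in> {0..<n}"
      then have "(\<Prod>k = 0..<n. x i - y k) = (x i - y j) * (\<Prod>k\<in>{0..<n} - {j}. x i - y k)"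
        by (intro prod.remove) auto
      with ne i j show "v $ j * (\<Prod>k\<in>{0..<n} - {j}. x i - y k) =
          (\<Prod>k = 0..<n. x i - y k) * (1 / (x i - y j) * v $ j)"
        by simp
    qed
    also have "\<dots> = (\<Prod>k = 0..<n. x i - y k) * (cauchy_mat n x y *\<^sub>v v) $ i"
      using v(1) i by (simp add: cauchy_mat_def scalar_prod_def sum_distrib_left)
    finally show ?thesis
      using v(3) i by simp
  qed
  have "p = 0"
    by (rule poly_eqI_degree[where A = "x ` {0..<n}"])
      (use deg \<open>n > 0\<close> root card_image[OF inj(1)] in auto)
  have "v $ j = 0" if j: "j < n" for j
  proof -
    have "0 = poly p (y j)"
      using \<open>p = 0\<close> by simp
    also have "\<dots> = (\<Sum>l = 0..<n. v $ l * (\<Prod>k\<in>{0..<n} - {l}. y j - y k))"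
      by (simp add: p_def L_def poly_sum poly_prod)
    also have "\<dots> = (\<Sum>l\<in>{j}. v $ l * (\<Prod>k\<in>{0..<n} - {l}. y j - y k))"
      using j by (intro sum.mono_neutral_right) auto
    finally have "v $ j * (\<Prod>k\<in>{0..<n} - {j}. y j - y k) = 0"
      by simp
    moreover have "(\<Prod>k\<in>{0..<n} - {j}. y j - y k) \<noteq> 0"
      using inj(2) j by (auto simp: inj_on_def)
    ultimately show ?thesis
      by simp
  qed
  with v show False
    by auto
qed

section \<open>The Cauchy matrix of the roots of \<open>x\<^sup>n + a\<close> and \<open>x\<^sup>n - a\<close>\<close>

lemma diff_mult_sum_powers:
  fixes x y :: "'a :: comm_ring_1"
  shows "(x - y) * (\<Sum>m<n. x ^ (n - Suc m) * y ^ m) = x ^ n - y ^ n"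
  using power_diff_sumr2[of y n x] by (simp add: algebra_simps)

text \<open>
  Multiplying by \<open>x - y\<close> makes the weighted sum telescope to the unweighted one, up to a
  boundary term.
\<close>

lemma diff_mult_weighted_sum_powers:
  fixes x y :: "'a :: comm_ring_1"
  shows "(x - y) * (\<Sum>m<n. of_nat m * (x ^ (n - Suc m) * y ^ m)) =
    y * (\<Sum>m<n. x ^ (n - Suc m) * y ^ m) - of_nat n * y ^ n"
proof (induction n)
  case (Suc n)
  have step: "(\<Sum>m<Suc n. f m * (x ^ (Suc n - Suc m) * y ^ m)) =
      x * (\<Sum>m<n. f m * (x ^ (n - Suc m) * y ^ m)) + f n * y ^ n" for f :: "nat \<Rightarrow> 'a"
  proof -
    have "f m * (x ^ (Suc n - Suc m) * y ^ m) = x * (f m * (x ^ (n - Suc m) * y ^ m))"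
      if "m < n" for m
    proof -
      have "Suc n - Suc m = Suc (n - Suc m)"
        using that by simp
      then show ?thesis
        by (simp only: power_Suc mult_ac)
    qed
    then show ?thesis
      by (simp add: sum_distrib_left)
  qed
  let ?F = "\<Sum>m<n. of_nat m * (x ^ (n - Suc m) * y ^ m)"
  let ?G = "\<Sum>m<n. x ^ (n - Suc m) * y ^ m"
  have "(x - y) * (x * ?F + of_nat n * y ^ n) = x * ((x - y) * ?F) + (x - y) * (of_nat n * y ^ n)"
    by (simp only: ring_distribs left_diff_distrib right_diff_distrib mult_ac)
  also have "\<dots> = y * (x * ?G + y ^ n) - of_nat (Suc n) * y ^ Suc n"
    unfolding Suc.IH by (simp add: algebra_simps)
  finally show ?case
    unfolding step step[of "\<lambda>_. 1", unfolded mult_1] .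
qed simp

lemma inverse_diff_conv_sum_powers:
  fixes x y a :: "'a :: field"
  assumes "x ^ n = - a" "y ^ n = a" "x \<noteq> y" "2 * a \<noteq> 0"
  shows "1 / (x - y) = (\<Sum>m<n. x ^ (n - Suc m) * (- 1 / (2 * a)) * y ^ m)"
proof -
  have "(x - y) * (\<Sum>m<n. x ^ (n - Suc m) * y ^ m) = - (2 * a)"
    unfolding diff_mult_sum_powers using assms by simp
  then have "1 / (x - y) = - 1 / (2 * a) * (\<Sum>m<n. x ^ (n - Suc m) * y ^ m)"
    using assms by (simp add: field_simps)
  then show ?thesis
    by (simp add: sum_distrib_left mult_ac)
qed

text \<open>
  The square of the geometric sum contains the monomials \<open>x\<^bsup>2n-2-m\<^esup> y\<^bsup>m\<^esup>\<close> for
  \<open>m \<le> 2n - 2\<close>. Reduction by \<open>x\<^sup>n = -a\<close> and \<open>y\<^sup>n = a\<close> leaves \<open>n\<close> of them; after a factor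
  \<open>1/x\<close> is taken out, they are the monomials of the geometric sum itself, so that
  both matrices have the same two outer factors.
\<close>

lemma inverse_diff_squared_conv_sum_powers:
  fixes x y a :: "'a :: field"
  assumes "x ^ n = - a" "y ^ n = a" "x \<noteq> y" "2 * a \<noteq> 0" "x \<noteq> 0"
  shows "1 / (x - y)\<^sup>2 =
    1 / x * (\<Sum>m<n. x ^ (n - Suc m) * ((of_nat n - 2 - 2 * of_nat m) / (4 * a)) * y ^ m)"
proof -
  define G where "G = (\<Sum>m<n. x ^ (n - Suc m) * y ^ m)"
  define F where "F = (\<Sum>m<n. of_nat m * (x ^ (n - Suc m) * y ^ m))"
  have G: "(x - y) * G = - (2 * a)"
    unfolding G_def diff_mult_sum_powers using assms by simp
  have F: "(x - y) * F = y * G - of_nat n * a"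
    unfolding G_def F_def diff_mult_weighted_sum_powers using assms by simp
  (* (n - 2) * G - 2 * F is the sum of the monomials with the weights n - 2 - 2 * m. *)
  have "(x - y)\<^sup>2 * ((of_nat n - 2) * G - 2 * F) =
      (x - y) * ((of_nat n - 2) * ((x - y) * G) - 2 * ((x - y) * F))"
    by (simp add: algebra_simps power2_eq_square)
  also have "\<dots> = (x - y) * ((of_nat n - 2) * (- (2 * a)) - 2 * (y * G - of_nat n * a))"
    by (simp only: F G)
  also have "\<dots> = 4 * a * (x - y) - 2 * y * ((x - y) * G)"
    by (simp add: algebra_simps)
  also have "\<dots> = 4 * a * x"
    unfolding G by (simp add: algebra_simps)
  finally have key: "(x - y)\<^sup>2 * ((of_nat n - 2) * G - 2 * F) = 4 * a * x" .
  have "(4 :: 'a) = 2 * 2"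
    by simp
  with assms(4) have "4 * a \<noteq> 0"
    by (metis mult_eq_0_iff)
  with key assms have "1 / (x - y)\<^sup>2 = 1 / x * (((of_nat n - 2) * G - 2 * F) / (4 * a))"
    by (simp add: divide_simps mult_ac)
  also have "((of_nat n - 2) * G - 2 * F) / (4 * a) =
      (\<Sum>m<n. x ^ (n - Suc m) * ((of_nat n - 2 - 2 * of_nat m) / (4 * a)) * y ^ m)"
    unfolding G_def F_def sum_distrib_left sum_subtractf[symmetric] sum_divide_distrib
    by (intro sum.cong refl) (simp add: algebra_simps diff_divide_distrib add_divide_distrib)
  finally show ?thesis .
qed

text \<open>Vieta's formula for the constant coefficient of \<open>X\<^sup>n + a\<close>.\<close>

lemma prod_uminus_roots_of_power_eq:
  fixes x :: "nat \<Rightarrow> 'a :: field"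
  assumes "n > 0" "inj_on x {0..<n}" "\<And>i. i < n \<Longrightarrow> x i ^ n = - a"
  shows "(\<Prod>i = 0..<n. - x i) = a"
proof -
  define q where "q = (\<Prod>i = 0..<n. [:- x i, 1:])"
  have deg: "degree q = n"
    unfolding q_def by (subst degree_prod_sum_eq) auto
  have "lead_coeff q = 1"
    unfolding q_def lead_coeff_prod by simp
  have "q = monom 1 n + [:a:]"
  proof (rule poly_eqI_degree_lead_coeff[where A = "x ` {0..<n}" and n = n])
    show "coeff q n = coeff (monom 1 n + [:a:]) n"
      using deg \<open>lead_coeff q = 1\<close> \<open>n > 0\<close> by (auto simp: coeff_pCons split: nat.split)
    show "degree (monom 1 n + [:a:]) \<le> n"
      by (intro degree_add_le) (auto simp: degree_monom_le)
    show "poly q z = poly (monom 1 n + [:a:]) z" if z: "z \<in> x ` {0..<n}" for z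
    proof -
      obtain i where i: "i < n" "z = x i"
        using z by auto
      then have "poly q z = 0"
        by (auto simp: q_def poly_prod intro!: prod_zero)
      with i assms(3) show ?thesis
        by (simp add: poly_monom)
    qed
  qed (use deg card_image[OF assms(2)] in auto)
  then have "poly q 0 = poly (monom 1 n + [:a:]) 0"
    by simp
  with \<open>n > 0\<close> show ?thesis
    by (simp add: q_def poly_prod poly_monom)
qed

lemma det_mat_diag: "det (mat_diag n f) = (\<Prod>i = 0..<n. f i)"
  for f :: "nat \<Rightarrow> 'a :: comm_ring_1"
  by (subst det_upper_triangular[of _ n])
    (auto simp: mat_diag_def upper_triangular_def prod_list_diag_prod)

text \<open>
  The factorizations \<open>V D W\<close> of the Cauchy matrix and \<open>E V D' W\<close> of the matrix of the squares
  are read off entrywise from the expansions of \<open>1/(x - y)\<close> and \<open>1/(x - y)\<^sup>2\<close>. Because the Cauchy matrix is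
  nonsingular, \<open>det V \<cdot> det W \<noteq> 0\<close> can be cancelled without evaluating these Vandermonde
  determinants.
\<close>

lemma permanent_cauchy_mat_roots:
  fixes x y :: "nat \<Rightarrow> 'a :: field"
  assumes "n > 0" and "2 * a \<noteq> 0"
    and inj: "inj_on x {0..<n}" "inj_on y {0..<n}"
    and xn: "\<And>i. i < n \<Longrightarrow> x i ^ n = - a"
    and yn: "\<And>i. i < n \<Longrightarrow> y i ^ n = a"
  shows "permanent (cauchy_mat n x y) =
    (\<Prod>m = 0..<n. of_nat n - 2 - 2 * of_nat m) / (2 ^ n * a)"
proof -
  define V where "V = mat n n (\<lambda>(i, m). x i ^ (n - Suc m))"
  define W where "W = mat n n (\<lambda>(m, j). y j ^ m)"
  define d where "d m = (of_nat n - 2 - 2 * of_nat m) / (4 * a)" for m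
  have ne: "x i \<noteq> y j" if "i < n" "j < n" for i j
  proof
    assume "x i = y j"
    with xn[OF that(1)] yn[OF that(2)] have "a = - a"
      by simp
    then have "a + a = 0"
      by (metis add.right_inverse)
    with \<open>2 * a \<noteq> 0\<close> show False
      by (metis mult_2)
  qed
  have x0: "x i \<noteq> 0" if "i < n" for i
    using xn[OF that] \<open>n > 0\<close> \<open>2 * a \<noteq> 0\<close> by (auto simp: zero_power)
  have V [simp]: "V \<in> carrier_mat n n" and W [simp]: "W \<in> carrier_mat n n"
    by (simp_all add: V_def W_def)
  have VDW: "(V * mat_diag n f * W) $$ (i, j) = (\<Sum>m<n. x i ^ (n - Suc m) * f m * y j ^ m)"
    if "i < n" "j < n" for f i j
    using that by (subst mat_diag_mult_right[of _ n])
      (auto simp: V_def W_def scalar_prod_def lessThan_atLeast0)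
  have det_VDW: "det (V * mat_diag n f * W) = det V * (\<Prod>m = 0..<n. f m) * det W" for f
    using det_mult[OF mult_carrier_mat[OF V mat_diag_dim] W] det_mult[OF V mat_diag_dim]
    by (simp add: det_mat_diag)

  have "cauchy_mat n x y = V * mat_diag n (\<lambda>_. - 1 / (2 * a)) * W"
  proof (rule eq_matI, goal_cases)
    case (1 i j)
    then have ij: "i < n" "j < n"
      using W V by auto
    show ?case
      unfolding VDW[OF ij] using ij
      by (simp add: cauchy_mat_def inverse_diff_conv_sum_powers[OF xn yn ne \<open>2 * a \<noteq> 0\<close>])
  qed (simp_all add: cauchy_mat_def V_def W_def)
  then have det_cauchy: "det (cauchy_mat n x y) = det V * (- 1 / (2 * a)) ^ n * det W"
    by (simp add: det_VDW)

  have "mat n n (\<lambda>(i, j). 1 / (x i - y j)\<^sup>2) =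
      mat_diag n (\<lambda>i. 1 / x i) * (V * mat_diag n d * W)"
  proof (subst mat_diag_mult_left[of _ n n], goal_cases)
    case 2
    show ?case
    proof (rule eq_matI, goal_cases)
      case (1 i j)
      then have ij: "i < n" "j < n"
        by auto
      show ?case
        using ij VDW[OF ij]
        by (simp add: d_def
            inverse_diff_squared_conv_sum_powers[OF xn yn ne \<open>2 * a \<noteq> 0\<close> x0])
    qed auto
  qed (auto intro!: mult_carrier_mat[of _ _ n])
  then have det_squares: "det (mat n n (\<lambda>(i, j). 1 / (x i - y j)\<^sup>2)) =
      (\<Prod>i = 0..<n. 1 / x i) * (det V * (\<Prod>m = 0..<n. d m) * det W)"
    by (simp add: det_mult[of _ n] det_mat_diag mult_carrier_mat[of _ _ n])

  have det_ne: "det (cauchy_mat n x y) \<noteq> 0"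
    using inj ne by (rule det_cauchy_mat_nonzero)
  then have VW: "det V * det W \<noteq> 0"
    unfolding det_cauchy by auto
  have "(permanent (cauchy_mat n x y) * (- 1 / (2 * a)) ^ n) * (det V * det W) =
      ((\<Prod>i = 0..<n. 1 / x i) * (\<Prod>m = 0..<n. d m)) * (det V * det W)"
    using borchardt[where x = x, OF inj(2) ne] unfolding det_squares det_cauchy
    by (simp only: mult_ac)
  with VW have per: "permanent (cauchy_mat n x y) * (- 1 / (2 * a)) ^ n =
      (\<Prod>i = 0..<n. 1 / x i) * (\<Prod>m = 0..<n. d m)"
    by simp
  have "(\<Prod>i = 0..<n. - x i) = a"
    using \<open>n > 0\<close> inj(1) xn by (rule prod_uminus_roots_of_power_eq)
  then have a: "a = (- 1) ^ n * (\<Prod>i = 0..<n. x i)"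
    by (subst (asm) prod_uminus) simp
  have "(\<Prod>i = 0..<n. 1 / x i) = 1 / (\<Prod>i = 0..<n. x i)"
    by (simp add: prod_dividef)
  also have "\<dots> = (- 1) ^ n / a"
    unfolding a by (cases "even n") simp_all
  finally have prod_x: "(\<Prod>i = 0..<n. 1 / x i) = (- 1) ^ n / a" .
  have "4 * a = (2 * a) * 2"
    by simp
  then have "(4 * a) ^ n = (2 * a) ^ n * 2 ^ n"
    by (simp only: power_mult_distrib[of "2 * a" 2])
  then have prod_d: "(\<Prod>m = 0..<n. d m) =
      (\<Prod>m = 0..<n. of_nat n - 2 - 2 * of_nat m) / ((2 * a) ^ n * 2 ^ n)"
    by (simp add: d_def prod_dividef)
  define c where "c = (- 1 / (2 * a)) ^ n"
  have c: "c = (- 1) ^ n / (2 * a) ^ n"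
    unfolding c_def by (simp only: power_divide)
  have "permanent (cauchy_mat n x y) * c =
      (\<Prod>m = 0..<n. of_nat n - 2 - 2 * of_nat m) / (2 ^ n * a) * c"
    using per unfolding prod_x prod_d c_def[symmetric] by (simp add: c mult_ac)
  moreover have "c \<noteq> 0"
    unfolding c using \<open>2 * a \<noteq> 0\<close> by simp
  ultimately show ?thesis
    using mult_right_cancel by blast
qed

text \<open>
  The factors are \<open>n - 2, n - 4, \<dots>, -(n - 2), -n\<close>. If \<open>n\<close> is odd, the reflection
  \<open>m \<mapsto> n - 2 - m\<close> changes the sign of each factor but the last; if \<open>n\<close> is even and positive,
  one factor is \<open>0\<close>.
\<close>

lemma prod_shifted_even_differences:
  "(\<Prod>m = 0..<n. of_nat n - 2 - 2 * of_nat m :: 'a :: comm_ring_1) =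
    (if odd n
     then (- 1) ^ ((n + 1) div 2) * of_nat n *
          (\<Prod>k = 1..(n - 1) div 2. of_nat n - 2 * of_nat k)\<^sup>2
     else if n = 0 then 1 else 0)"
proof (cases "odd n")
  case True
  then obtain h where n: "n = 2 * h + 1"
    by (auto elim: oddE)
  let ?f = "\<lambda>m. of_nat n - 2 - 2 * of_nat m :: 'a"
  let ?P = "\<Prod>k = 1..h. of_nat n - 2 * of_nat k :: 'a"
  have first: "prod ?f {0..<h} = ?P"
    by (rule prod.reindex_bij_witness[of _ "\<lambda>k. k - 1" Suc]) (auto simp: algebra_simps)
  have "prod ?f {h..<2 * h} = (\<Prod>k = 1..h. - (of_nat n - 2 * of_nat k) :: 'a)"
    by (rule prod.reindex_bij_witness[of _ "\<lambda>k. 2 * h - k" "\<lambda>m. 2 * h - m"])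
      (auto simp: n of_nat_diff algebra_simps)
  also have "\<dots> = (- 1) ^ h * ?P"
    by (subst prod_uminus) simp
  finally have second: "prod ?f {h..<2 * h} = (- 1) ^ h * ?P" .
  have "prod ?f {0..<n} = prod ?f {0..<2 * h} * ?f (2 * h)"
    by (simp add: n)
  also have "prod ?f {0..<2 * h} = prod ?f {0..<h} * prod ?f {h..<2 * h}"
    by (simp add: prod.atLeastLessThan_concat)
  also have "?f (2 * h) = - of_nat n"
    by (simp add: n algebra_simps)
  finally have "prod ?f {0..<n} = ?P * ((- 1) ^ h * ?P) * - of_nat n"
    unfolding first second .
  moreover have "(n + 1) div 2 = Suc h" "(n - 1) div 2 = h"
    by (simp_all add: n)
  ultimately show ?thesis
    using True by (simp add: power2_eq_square mult_ac)
next
  case False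
  then obtain h where n: "n = 2 * h"
    by auto
  show ?thesis
  proof (cases h)
    case (Suc g)
    then have "(of_nat n - 2 - 2 * of_nat g :: 'a) = 0"
      by (simp add: n algebra_simps)
    then have "(\<Prod>m = 0..<n. of_nat n - 2 - 2 * of_nat m :: 'a) = 0"
      using Suc by (intro prod_zero) (auto simp: n intro!: bexI[of _ g])
    then show ?thesis
      by (simp add: n Suc)
  qed (simp add: n)
qed

section \<open>The permanent over the splitting field\<close>

theorem theorem4:
  fixes n :: nat
    and a :: "'k :: field"
    and \<iota> :: "'k \<Rightarrow> 'l :: field"
    and x y :: "nat \<Rightarrow> 'l"
  assumes "n \<ge> 1"
    and "CHAR('k) = 0 \<or> (CHAR('k) > 0 \<and> coprime CHAR('k) (2 * n))"
    and "a \<noteq> 0"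
    and "splitting_field \<iota> ((monom 1 n + [:a:]) * (monom 1 n - [:a:]))"
    and "bij_betw x {1..n} {z. poly (map_poly \<iota> (monom 1 n + [:a:])) z = 0}"
    and "bij_betw y {1..n} {z. poly (map_poly \<iota> (monom 1 n - [:a:])) z = 0}"
  shows "permanent (mat n n (\<lambda>(i, j). 1 / (x (i + 1) - y (j + 1)))) =
    (if odd n
     then (- 1) ^ ((n + 1) div 2) * (of_nat n / (2 ^ n * \<iota> a)) *
          (\<Prod>k = 1..(n - 1) div 2. of_nat n - 2 * of_nat k)\<^sup>2
     else 0)"
proof -
  interpret field_hom \<iota>
    using assms(4) by (simp add: splitting_field_def)
  (* The characteristic is not 2, so that 2 * a is nonzero; this keeps the two root sets disjoint. *)
  have "\<not> CHAR('k) dvd 2"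
  proof
    assume "CHAR('k) dvd 2"
    with assms(2) have "coprime CHAR('k) (2 * n)" "CHAR('k) dvd 2 * n"
      by auto
    then have "is_unit CHAR('k)"
      by (meson coprime_common_divisor dvd_refl)
    then show False
      by simp
  qed
  then have "of_nat 2 \<noteq> (0 :: 'k)"
    by (subst of_nat_eq_0_iff_char_dvd)
  then have "a + a \<noteq> 0"
    using assms(3) by (metis mult_2 mult_eq_0_iff of_nat_numeral)
  then have "\<iota> (a + a) \<noteq> 0"
    by simp
  then have "2 * \<iota> a \<noteq> 0"
    by (metis hom_add mult_2)
  have "map_poly \<iota> (monom 1 n + [:a:]) = monom 1 n + [:\<iota> a:]"
    by (rule poly_eqI) (auto simp: coeff_map_poly coeff_pCons hom_add split: nat.split)
  then have plus: "poly (map_poly \<iota> (monom 1 n + [:a:])) z = z ^ n + \<iota> a" for z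
    by (simp add: poly_monom)
  have "map_poly \<iota> (monom 1 n - [:a:]) = monom 1 n - [:\<iota> a:]"
    by (rule poly_eqI) (auto simp: coeff_map_poly coeff_pCons hom_minus split: nat.split)
  then have minus: "poly (map_poly \<iota> (monom 1 n - [:a:])) z = z ^ n - \<iota> a" for z
    by (simp add: poly_monom)
  have inj: "inj_on (\<lambda>i. x (i + 1)) {0..<n}" "inj_on (\<lambda>i. y (i + 1)) {0..<n}"
    using bij_betw_imp_inj_on[OF assms(5)] bij_betw_imp_inj_on[OF assms(6)]
    by (auto intro!: inj_onI dest!: inj_onD)
  have "x (i + 1) ^ n + \<iota> a = 0" "y (i + 1) ^ n - \<iota> a = 0" if "i < n" for i
    using bij_betwE[OF assms(5)] bij_betwE[OF assms(6)] that unfolding plus minus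
    by simp_all
  then have pow: "x (i + 1) ^ n = - \<iota> a" "y (i + 1) ^ n = \<iota> a" if "i < n" for i
    using that by (simp_all add: eq_neg_iff_add_eq_0)
  have "permanent (mat n n (\<lambda>(i, j). 1 / (x (i + 1) - y (j + 1)))) =
      (\<Prod>m = 0..<n. of_nat n - 2 - 2 * of_nat m) / (2 ^ n * \<iota> a)"
    using permanent_cauchy_mat_roots[OF _ \<open>2 * \<iota> a \<noteq> 0\<close> inj pow] assms(1)
    by (simp add: cauchy_mat_def)
  also have "\<dots> = (if odd n
     then (- 1) ^ ((n + 1) div 2) * (of_nat n / (2 ^ n * \<iota> a)) *
          (\<Prod>k = 1..(n - 1) div 2. of_nat n - 2 * of_nat k)\<^sup>2
     else 0)"
    unfolding prod_shifted_even_differences using assms(1) by auto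
  finally show ?thesis .
qed

end
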